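(* For every natural number $n>1$, \[ \lim_{N\to\infty}\frac{1}{N}\sum_{m=1}^{N}\prod_{p\mid m}\left(1+\frac{1}{p^{\,n-1}}\right)=\frac{\zeta(n)}{\zeta(2n)}, \] where the product runs over the primes $p$ dividing $m$ (the empty product, for $m=1$, equals $1$) and $\zeta$ is the Riemann zeta function. In particular, for $n=2$ the limit equals $15/\pi^2$. *)

theory Defs
  imports "HOL-Analysis.Analysis" "HOL-Number_Theory.Number_Theory"
begin

text \<open>The Riemann zeta function on the real half-line \<open>s > 1\<close>, where it is given by its Dirichlet
  series \<open>1 + 2\<^sup>-\<^sup>s + 3\<^sup>-\<^sup>s + \<dots>\<close>; the index is shifted by one. The value is meaningful only for
  \<open>s > 1\<close>: no analytic continuation is attempted.\<close>

definition zeta :: "real \<Rightarrow> real" where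
  "zeta s = (\<Sum>k. 1 / real (Suc k) powr s)"

end

theory Submission
  imports Defs "HOL-Computational_Algebra.Squarefree" "HOL-Real_Asymp.Real_Asymp"
begin

text \<open>
  Expanding the product over \<open>p \<bar> m\<close> gives the sum of \<open>d\<^bsup>1-n\<^esup>\<close> over the squarefree divisors \<open>d\<close>
  of \<open>m\<close>. Exchanging the two sums, the mean becomes \<open>\<Sum> \<lfloor>N/d\<rfloor>/N \<cdot> d\<^bsup>1-n\<^esup>\<close> over squarefree \<open>d\<close>, whose
  terms are dominated by \<open>d\<^bsup>-n\<^esup>\<close>, so by Tannery's theorem it tends to the sum of \<open>d\<^bsup>-n\<^esup>\<close> over
  squarefree \<open>d\<close>. The unique decomposition \<open>m = d k\<^sup>2\<close> with \<open>d\<close> squarefree shows that this sum times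
  \<open>\<zeta>(2n)\<close> is \<open>\<zeta>(n)\<close>.

  For \<open>n = 2\<close> the value \<open>\<zeta>(4) = \<pi>\<^sup>4/90\<close> is also needed. Multiplying Euler's sine product at \<open>x\<close> and at
  \<open>\<i>x\<close> gives \<open>sin(\<pi>x) sinh(\<pi>x)/(\<pi>x)\<^sup>2 = \<Prod> (1 - x\<^sup>4/k\<^sup>4)\<close>, and \<open>\<zeta>(4)\<close> is minus the coefficient of
  \<open>x\<^sup>4\<close>.
\<close>

section \<open>Squarefree divisors and products over primes\<close>

lemma squarefree_eq_prod_prime_factors:
  fixes d :: nat
  assumes "squarefree d"
  shows "\<Prod>(prime_factors d) = d"
proof -
  have d: "d > 0"
    using assms by (auto intro!: Nat.gr0I)
  have "d = (\<Prod>p\<in>prime_factors d. p ^ multiplicity p d)"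
    using d by (rule prime_factorization_nat)
  also have "\<dots> = \<Prod>(prime_factors d)"
    using assms d by (intro prod.cong) (auto simp: squarefree_factorial_semiring')
  finally show ?thesis ..
qed

lemma prod_prime_factors_dvd:
  fixes m :: nat
  assumes "m > 0"
  shows "\<Prod>(prime_factors m) dvd m"
proof -
  have "\<Prod>(prime_factors m) dvd (\<Prod>p\<in>prime_factors m. p ^ multiplicity p m)"
    by (intro prod_dvd_prod dvd_power) (auto simp: prime_factors_multiplicity)
  also have "\<dots> = m"
    using prime_factorization_nat[OF assms] ..
  finally show ?thesis .
qed

text \<open>The expanded product has one term for each set \<open>X\<close> of primes dividing
  \<open>m\<close>. Such sets correspond to the squarefree divisors of \<open>m\<close> through
  \<open>X \<mapsto> \<Prod>X\<close>, with inverse \<open>prime_factors\<close>.\<close>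

lemma prod_prime_divisors_eq_sum_squarefree:
  fixes m s :: nat
  assumes "m > 0"
  shows "(\<Prod>p | prime p \<and> p dvd m. 1 + 1 / real p ^ s) =
         (\<Sum>d | squarefree d \<and> d dvd m. 1 / real d ^ s)"
proof -
  let ?A = "{p. prime p \<and> p dvd m}"
  have A: "?A = prime_factors m"
    using assms by (auto simp: prime_factors_dvd)
  hence fin: "finite ?A"
    by simp
  have sub: "prime p" "p > 0" "finite X" if "X \<in> Pow ?A" "p \<in> X" for X p
    using that fin by (auto simp: prime_gt_0_nat intro: finite_subset)
  have pf: "prime_factors (\<Prod>X) = X" if X: "X \<in> Pow ?A" for X
  proof -
    have "finite X"
      using X fin by (auto intro: finite_subset)
    moreover have "\<And>p. p \<in> X \<Longrightarrow> prime p"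
      using X by auto
    ultimately show ?thesis
      using prime_factorization_prod_mset_primes[of "mset_set X"]
      by (simp add: prod_unfold_prod_mset)
  qed
  have "(\<Prod>p\<in>?A. 1 + 1 / real p ^ s) = (\<Sum>X\<in>Pow ?A. \<Prod>p\<in>X. 1 / real p ^ s)"
    using prod_add[OF fin, of "\<lambda>p. 1 / real p ^ s" "\<lambda>_. 1"] by (simp add: add.commute)
  also have "\<dots> = (\<Sum>d | squarefree d \<and> d dvd m. 1 / real d ^ s)"
  proof (rule sum.reindex_bij_witness[of _ prime_factors Prod])
    fix X assume X: "X \<in> Pow ?A"
    show "prime_factors (\<Prod>X) = X"
      by (rule pf[OF X])
    have "squarefree (\<Prod>X)"
      using X by (intro squarefree_prod_coprime) (auto intro: primes_coprime squarefree_prime)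
    moreover have "\<Prod>X dvd \<Prod>(prime_factors m)"
      using X A by (intro prod_dvd_prod_subset) auto
    hence "\<Prod>X dvd m"
      using prod_prime_factors_dvd[OF assms] by (rule dvd_trans)
    ultimately show "\<Prod>X \<in> {d. squarefree d \<and> d dvd m}"
      by simp
    show "1 / real (\<Prod>X) ^ s = (\<Prod>p\<in>X. 1 / real p ^ s)"
      by (simp add: prod_dividef prod_power_distrib)
  next
    fix d assume "d \<in> {d. squarefree d \<and> d dvd m}"
    thus "\<Prod>(prime_factors d) = d" "prime_factors d \<in> Pow ?A"
      by (auto simp: squarefree_eq_prod_prime_factors intro: dvd_trans)
  qed
  finally show ?thesis .
qed

section \<open>The mean value as a sum over squarefree numbers, and its limit\<close>

lemma card_multiples_atMost:
  fixes d N :: nat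
  assumes "d > 0"
  shows "card {m \<in> {1..N}. d dvd m} = N div d"
proof -
  have "{m \<in> {1..N}. d dvd m} = (\<lambda>k. d * k) ` {1..N div d}"
    using assms by (auto simp: image_iff less_eq_div_iff_mult_less_eq mult.commute elim!: dvdE)
  moreover have "inj_on (\<lambda>k. d * k) {1..N div d}"
    using assms by (auto simp: inj_on_def)
  ultimately show ?thesis
    by (simp add: card_image)
qed

lemma sum_prod_prime_divisors:
  fixes N s :: nat
  shows "(\<Sum>m=1..N. \<Prod>p | prime p \<and> p dvd m. 1 + 1 / real p ^ s) =
         (\<Sum>d\<in>{d\<in>{1..N}. squarefree d}. real (N div d) / real d ^ s)"
proof -
  have "(\<Sum>m=1..N. \<Prod>p | prime p \<and> p dvd m. 1 + 1 / real p ^ s) =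
        (\<Sum>m=1..N. \<Sum>d | d \<in> {d\<in>{1..N}. squarefree d} \<and> d dvd m. 1 / real d ^ s)"
  proof (intro sum.cong refl)
    fix m assume m: "m \<in> {1..N}"
    \<comment> \<open>Bounding \<open>d\<close> by \<open>N\<close> loses no divisor of
      \<open>m\<close> and makes the outer range independent of \<open>m\<close>, so that the two
      sums can be exchanged.\<close>
    have "{d. squarefree d \<and> d dvd m} = {d. d \<in> {d\<in>{1..N}. squarefree d} \<and> d dvd m}"
      using m by (auto simp: Suc_le_eq intro!: Nat.gr0I dest: dvd_imp_le)
    thus "(\<Prod>p | prime p \<and> p dvd m. 1 + 1 / real p ^ s) =
          (\<Sum>d | d \<in> {d\<in>{1..N}. squarefree d} \<and> d dvd m. 1 / real d ^ s)"
      using m by (simp add: prod_prime_divisors_eq_sum_squarefree)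
  qed
  also have "\<dots> = (\<Sum>d\<in>{d\<in>{1..N}. squarefree d}. \<Sum>m | m \<in> {1..N} \<and> d dvd m. 1 / real d ^ s)"
    by (rule sum.swap_restrict) auto
  also have "\<dots> = (\<Sum>d\<in>{d\<in>{1..N}. squarefree d}. real (N div d) / real d ^ s)"
    using card_multiples_atMost[of _ N] by (intro sum.cong) auto
  finally show ?thesis .
qed

lemma tendsto_nat_div_over:
  fixes d :: nat
  assumes "d > 0"
  shows "(\<lambda>N. real (N div d) / real N) \<longlonglongrightarrow> 1 / real d"
proof -
  have "(\<lambda>N. real (nat \<lfloor>real N / real d\<rfloor>) / real N) \<longlonglongrightarrow> 1 / real d"
    using assms by (real_asymp simp: inverse_eq_divide)
  thus ?thesis
    by (simp add: floor_divide_of_nat_eq)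
qed

lemma tendsto_mean_prod_prime_divisors:
  fixes s :: nat
  assumes "s > 0"
  shows "(\<lambda>N. 1 / real N * (\<Sum>m=1..N. \<Prod>p | prime p \<and> p dvd m. 1 + 1 / real p ^ s))
           \<longlonglongrightarrow> (\<Sum>d. if squarefree d then 1 / real d ^ Suc s else 0)"
proof -
  \<comment> \<open>For \<open>d > N\<close> the quotient \<open>N div d\<close> is 0, and 0 is not
    squarefree. The finite sum over \<open>{1..N}\<close> is therefore a series over all
    \<open>d\<close>, the form that Tannery's theorem needs.\<close>
  define a where "a d N = (if squarefree d then real (N div d) / real N / real d ^ s else 0)"
    for d N :: nat
  have "(\<lambda>N. \<Sum>d. a d N) \<longlonglongrightarrow> (\<Sum>d. if squarefree d then 1 / real d ^ Suc s else 0)"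
  proof (rule conjunct2[OF conjunct2[OF tannerys_theorem]])
    fix d :: nat
    show "a d \<longlonglongrightarrow> (if squarefree d then 1 / real d ^ Suc s else 0)"
    proof (cases "squarefree d")
      case True
      hence d: "d > 0"
        by (auto intro!: Nat.gr0I)
      show ?thesis
        using tendsto_divide[OF tendsto_nat_div_over[OF d] tendsto_const[of "real d ^ s"]] d True
        by (simp add: a_def[abs_def])
    qed (simp add: a_def[abs_def])
  next
    have "norm (a d N) \<le> 1 / real d ^ Suc s" for d N
    proof (cases "N = 0 \<or> \<not> squarefree d")
      case False
      hence "d > 0"
        by (auto intro!: Nat.gr0I)
      have "real (N div d) \<le> real N / real d"
        by (simp add: of_nat_div_le_of_nat)
      hence "real (N div d) / real N \<le> 1 / real d"
        using False \<open>d > 0\<close> by (simp add: field_simps)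
      hence "real (N div d) / real N / real d ^ s \<le> 1 / real d / real d ^ s"
        by (intro divide_right_mono) auto
      thus ?thesis
        by (simp add: a_def)
    qed (auto simp: a_def)
    thus "\<forall>\<^sub>F (d, N) in at_top \<times>\<^sub>F sequentially. norm (a d N) \<le> 1 / real d ^ Suc s"
      by (intro always_eventually) auto
    show "summable (\<lambda>d. 1 / real d ^ Suc s)"
      using inverse_power_summable[of "Suc s", where 'a = real] assms
      by (simp add: inverse_eq_divide)
  qed simp
  moreover have "(\<Sum>d. a d N) =
      1 / real N * (\<Sum>m=1..N. \<Prod>p | prime p \<and> p dvd m. 1 + 1 / real p ^ s)" for N
  proof -
    have "(\<Sum>d. a d N) = (\<Sum>d\<in>{d\<in>{1..N}. squarefree d}. a d N)"
      by (rule suminf_finite) (auto simp: a_def Suc_le_eq not_le intro!: Nat.gr0I)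
    also have "\<dots> = 1 / real N * (\<Sum>d\<in>{d\<in>{1..N}. squarefree d}. real (N div d) / real d ^ s)"
      unfolding sum_distrib_left by (intro sum.cong) (auto simp: a_def)
    finally show ?thesis
      by (simp only: sum_prod_prime_divisors)
  qed
  ultimately show ?thesis
    by simp
qed

section \<open>Zeta values and the decomposition into a squarefree number and a square\<close>

lemma zeta_of_nat_sums:
  assumes "n > 1"
  shows "(\<lambda>k. 1 / real (Suc k) ^ n) sums zeta (real n)"
proof -
  have "summable (\<lambda>k. 1 / real (Suc k) ^ n)"
    using inverse_power_summable[of n, where 'a = real] assms
    by (subst summable_Suc_iff) (simp add: inverse_eq_divide)
  moreover have "zeta (real n) = (\<Sum>k. 1 / real (Suc k) ^ n)"
    unfolding zeta_def by (simp add: powr_realpow del: of_nat_Suc)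
  ultimately show ?thesis
    by (simp add: summable_sums)
qed

text \<open>The series is restated as an unordered sum because it will be reindexed by pairs
  \<open>(d, k)\<close>; the terms being nonnegative, convergence suffices for this.\<close>

lemma zeta_of_nat_has_sum:
  assumes "n > 1"
  shows "((\<lambda>k. 1 / real k ^ n) has_sum zeta (real n)) {0<..}"
proof -
  have "((\<lambda>k. 1 / real (Suc k) ^ n) has_sum zeta (real n)) UNIV"
    by (rule sums_nonneg_imp_has_sum[OF zeta_of_nat_sums[OF assms]]) simp
  moreover have "bij_betw Suc UNIV {0<..}"
    by (auto simp: bij_betw_def image_iff gr0_conv_Suc)
  ultimately show ?thesis
    using has_sum_reindex_bij_betw[of Suc UNIV "{0<..}" "\<lambda>k. 1 / real k ^ n"] by simp
qed

text \<open>This is the uniqueness of the decomposition. The exponent of a prime in the square part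
  is half the total exponent, rounded down; as its exponent in \<open>d\<close> is at most 1,
  halving and rounding leaves exactly its exponent in \<open>k\<close>.\<close>

lemma squarefree_square_part_mult:
  fixes d k :: nat
  assumes "squarefree d" "k > 0"
  shows "square_part (d * k\<^sup>2) = k" "squarefree_part (d * k\<^sup>2) = d"
proof -
  have d: "d > 0"
    using assms by (auto intro!: Nat.gr0I)
  have "multiplicity p (square_part (d * k\<^sup>2)) = multiplicity p k" if p: "prime p" for p
  proof -
    have "multiplicity p d \<le> 1"
      using assms d p by (simp add: squarefree_factorial_semiring'')
    moreover have "multiplicity p (d * k\<^sup>2) = multiplicity p d + 2 * multiplicity p k"
      using p d assms
      by (simp add: prime_elem_multiplicity_mult_distrib prime_elem_multiplicity_power_distrib)
    ultimately show ?thesis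
      using p by (simp add: prime_multiplicity_square_part)
  qed
  thus *: "square_part (d * k\<^sup>2) = k"
    by (rule multiplicity_eq_nat[rotated 2]) (use d assms in \<open>auto intro!: Nat.gr0I\<close>)
  show "squarefree_part (d * k\<^sup>2) = d"
    using squarefree_decompose[of "d * k\<^sup>2"] assms(2) unfolding * by simp
qed

lemma suminf_squarefree_times_zeta:
  assumes "n > 1"
  shows "(\<Sum>d. if squarefree d then 1 / real d ^ n else 0) * zeta (real (2 * n)) = zeta (real n)"
proof -
  let ?S = "\<Sum>d. if squarefree d then 1 / real d ^ n else 0"
  have "summable (\<lambda>d. 1 / real d ^ n)"
    using inverse_power_summable[of n, where 'a = real] assms by (simp add: inverse_eq_divide)
  hence "summable (\<lambda>d. if squarefree d then 1 / real d ^ n else 0)"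
    by (rule summable_comparison_test'[where N = 0]) auto
  hence "((\<lambda>d. if squarefree d then 1 / real d ^ n else 0) has_sum ?S) UNIV"
    by (intro sums_nonneg_imp_has_sum summable_sums) auto
  hence S: "((\<lambda>d. 1 / real d ^ n) has_sum ?S) {d. squarefree d}"
    by (subst (asm) has_sum_cong_neutral[where T = "{d. squarefree d}"
          and g = "\<lambda>d. 1 / real d ^ n"]) auto
  have Z: "((\<lambda>k. 1 / real k ^ (2 * n)) has_sum zeta (real (2 * n))) {0<..}"
    using assms by (intro zeta_of_nat_has_sum) simp
  have "((\<lambda>(d, k). 1 / real (d * k\<^sup>2) ^ n) has_sum zeta (real n)) ({d. squarefree d} \<times> {0<..})
        \<longleftrightarrow> ((\<lambda>m. 1 / real m ^ n) has_sum zeta (real n)) {0<..}"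
  proof (rule has_sum_reindex_bij_witness[where
        i = "\<lambda>m. (squarefree_part m, square_part m)" and j = "\<lambda>(d, k). d * k\<^sup>2"])
    fix m :: nat assume "m \<in> {0<..}"
    thus "(squarefree_part m, square_part m) \<in> {d. squarefree d} \<times> {0<..}"
      by (auto intro!: Nat.gr0I)
    show "(case (squarefree_part m, square_part m) of (d, k) \<Rightarrow> d * k\<^sup>2) = m"
      using squarefree_decompose[of m] by simp
  qed (auto simp: squarefree_square_part_mult intro!: Nat.gr0I)
  hence 1: "((\<lambda>(d, k). 1 / real (d * k\<^sup>2) ^ n) has_sum zeta (real n))
              ({d. squarefree d} \<times> {0<..})"
    using zeta_of_nat_has_sum[OF assms] by simp
  \<comment> \<open>The double sum is evaluated a second time, first over \<open>k\<close> and then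
    over \<open>d\<close>; uniqueness of sums then compares the two values.\<close>
  have 2: "((\<lambda>k. 1 / real (d * k\<^sup>2) ^ n) has_sum (1 / real d ^ n * zeta (real (2 * n)))) {0<..}"
    for d
    using has_sum_cmult_right[OF Z, of "1 / real d ^ n"]
    by (simp add: power_mult_distrib power_mult)
  have "((\<lambda>d. 1 / real d ^ n * zeta (real (2 * n))) has_sum zeta (real n)) {d. squarefree d}"
    using 2 by (intro has_sum_SigmaD[OF 1]) auto
  with has_sum_cmult_left[OF S, of "zeta (real (2 * n))"] show ?thesis
    by (rule has_sum_unique)
qed

section \<open>The value of zeta at 4\<close>

lemma sin_sinh_product_formula:
  assumes "x \<noteq> (0::real)"
  shows "(\<lambda>n. \<Prod>k=1..n. 1 - x ^ 4 / real k ^ 4) \<longlonglongrightarrow> sin (pi * x) * sinh (pi * x) / (pi * x)\<^sup>2"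
proof -
  \<comment> \<open>At \<open>\<i> * x\<close> both the partial products and the limit are
    \<open>\<i>\<close> times a real number. Cancelling \<open>\<i>\<close> leaves a real product
    formula for \<open>sinh\<close>.\<close>
  have "(\<lambda>n. complex_of_real (pi * x * (\<Prod>k=1..n. 1 + x\<^sup>2 / real k ^ 2)) * \<i>)
          \<longlonglongrightarrow> sin (of_real pi * (\<i> * of_real x))"
    using sin_product_formula_complex[of "\<i> * of_real x"] by (simp add: power_mult_distrib mult_ac)
  also have "sin (of_real pi * (\<i> * of_real x)) = complex_of_real (sinh (pi * x)) * \<i>"
    using sin_i_times[of "of_real (pi * x)"]
    by (simp add: mult_ac sinh_field_def exp_minus flip: exp_of_real)
  finally have "(\<lambda>n. complex_of_real (pi * x * (\<Prod>k=1..n. 1 + x\<^sup>2 / real k ^ 2)) * \<i> / \<i>)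
          \<longlonglongrightarrow> complex_of_real (sinh (pi * x)) * \<i> / \<i>"
    by (intro tendsto_divide tendsto_const) auto
  hence "(\<lambda>n. pi * x * (\<Prod>k=1..n. 1 + x\<^sup>2 / real k ^ 2)) \<longlonglongrightarrow> sinh (pi * x)"
    by (simp only: nonzero_mult_div_cancel_right complex_i_not_zero not_False_eq_True
        tendsto_of_real_iff)
  from tendsto_divide[OF this tendsto_const[of "pi * x"]] assms
  have "(\<lambda>n. \<Prod>k=1..n. 1 + x\<^sup>2 / real k ^ 2) \<longlonglongrightarrow> sinh (pi * x) / (pi * x)"
    by simp
  from tendsto_mult[OF sin_product_formula_real'[OF assms] this]
  show ?thesis
    by (simp add: algebra_simps power2_eq_square eval_nat_numeral flip: prod.distrib)
qed

text \<open>The coefficient of \<open>x ^ 4\<close> is extracted as a limit at 0, computed in two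
  ways: term by term from a series, where \<open>P x k\<close> tends to 1, and from the closed form
  of its sum.\<close>

lemma inverse_fourth_powers_sums: "(\<lambda>n. 1 / real (Suc n) ^ 4) sums (pi ^ 4 / 90)"
proof -
  define P where "P x n = (\<Prod>k=1..n. 1 - x ^ 4 / real k ^ 4)" for x :: real and n
  have summ: "summable (\<lambda>k. 1 / real (Suc k) ^ 4)"
    using inverse_power_summable[of 4, where 'a = real]
    by (subst summable_Suc_iff) (simp add: inverse_eq_divide)
  have suminf: "(\<Sum>k. P x k / real (Suc k) ^ 4) =
      (1 - sin (pi * x) * sinh (pi * x) / (pi * x)\<^sup>2) / x ^ 4" if "x \<noteq> 0" for x
  proof -
    \<comment> \<open>One minus the infinite product, as a telescoping sum over its partial products.\<close>
    have "(\<lambda>k. P x k - P x (Suc k)) sums (P x 0 - sin (pi * x) * sinh (pi * x) / (pi * x)\<^sup>2)"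
      unfolding P_def by (intro telescope_sums' sin_sinh_product_formula that)
    also have "(\<lambda>k. P x k - P x (Suc k)) = (\<lambda>k. x ^ 4 / real (Suc k) ^ 4 * P x k)"
      unfolding P_def by (simp add: prod.nat_ivl_Suc' algebra_simps)
    also have "P x 0 = 1"
      by (simp add: P_def)
    finally have "(\<lambda>k. x ^ 4 / real (Suc k) ^ 4 * P x k) sums
                    (1 - sin (pi * x) * sinh (pi * x) / (pi * x)\<^sup>2)" .
    from sums_divide[OF this, of "x ^ 4"] that show ?thesis
      by (simp add: sums_iff del: of_nat_Suc)
  qed
  have "((\<lambda>x. \<Sum>k. P x k / real (Suc k) ^ 4) \<longlongrightarrow> (\<Sum>k. 1 / real (Suc k) ^ 4)) (at 0)"
  proof (rule conjunct2[OF conjunct2[OF tannerys_theorem]])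
    fix k :: nat
    have "((\<lambda>x. P x k / real (Suc k) ^ 4) \<longlongrightarrow> P 0 k / real (Suc k) ^ 4) (at 0)"
      unfolding P_def by (intro tendsto_intros) auto
    also have "P 0 k = 1"
      by (simp add: P_def)
    finally show "((\<lambda>x. P x k / real (Suc k) ^ 4) \<longlongrightarrow> 1 / real (Suc k) ^ 4) (at 0)" .
  next
    have le: "norm (P x k / real (Suc k) ^ 4) \<le> 1 / real (Suc k) ^ 4" if x: "\<bar>x\<bar> < 1" for k x
    proof -
      \<comment> \<open>All factors lie in the unit interval, so \<open>P x k\<close> is bounded by
        1 uniformly in \<open>k\<close> and in \<open>x\<close> near 0.\<close>
      have bounds: "1 - x ^ 4 / real i ^ 4 \<in> {0..1}" if "i \<in> {1..k}" for i
      proof -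
        have "x ^ 4 = \<bar>x\<bar> ^ 4"
          by simp
        also have "\<bar>x\<bar> ^ 4 \<le> 1"
          using x by (intro power_le_one) auto
        also have "1 \<le> real i ^ 4"
          using that by simp
        finally show ?thesis
          using that by simp
      qed
      have "\<bar>P x k\<bar> \<le> (\<Prod>i=1..k. 1)"
        unfolding P_def abs_prod using bounds by (intro prod_mono) auto
      thus ?thesis
        by (simp add: divide_right_mono)
    qed
    have "\<forall>\<^sub>F x in at 0. \<bar>x\<bar> < (1::real)"
      by (auto simp: eventually_at intro!: exI[of _ 1])
    hence "\<forall>\<^sub>F kx in (at_top :: nat filter) \<times>\<^sub>F at (0::real). True \<and> \<bar>snd kx\<bar> < 1"
      by (intro eventually_prodI) auto
    thus "\<forall>\<^sub>F (k, x) in at_top \<times>\<^sub>F at 0. norm (P x k / real (Suc k) ^ 4) \<le> 1 / real (Suc k) ^ 4"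
      by (rule eventually_mono) (use le in auto)
  qed (use summ in auto)
  moreover have "((\<lambda>x. \<Sum>k. P x k / real (Suc k) ^ 4) \<longlongrightarrow> pi ^ 4 / 90) (at 0)"
  proof (rule Lim_transform_eventually)
    \<comment> \<open>The \<open>y ^ 6\<close> coefficient of \<open>sin y * sinh y\<close> is 1/120
      - 1/36 + 1/120 = -1/90. Substituting \<open>y = pi * x\<close> supplies the factor
      \<open>pi ^ 4\<close>.\<close>
    have "((\<lambda>y::real. (1 - sin y * sinh y / y\<^sup>2) / y ^ 4) \<longlongrightarrow> 1 / 90) (at 0)"
      by real_asymp
    moreover have "filterlim (\<lambda>x. pi * x) (at 0) (at 0)"
      by (auto simp: filterlim_at eventually_at intro!: tendsto_eq_intros exI[of _ 1])
    ultimately have "((\<lambda>x. (1 - sin (pi * x) * sinh (pi * x) / (pi * x)\<^sup>2) / (pi * x) ^ 4)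
                       \<longlongrightarrow> 1 / 90) (at 0)"
      by (rule filterlim_compose)
    from tendsto_mult[OF tendsto_const[of "pi ^ 4"] this]
    show "((\<lambda>x. (1 - sin (pi * x) * sinh (pi * x) / (pi * x)\<^sup>2) / x ^ 4) \<longlongrightarrow> pi ^ 4 / 90) (at 0)"
      by (simp add: power_mult_distrib)
    show "\<forall>\<^sub>F x in at 0. (1 - sin (pi * x) * sinh (pi * x) / (pi * x)\<^sup>2) / x ^ 4 =
                         (\<Sum>k. P x k / real (Suc k) ^ 4)"
      by (auto simp: eventually_at suminf simp del: of_nat_Suc intro!: exI[of _ 1])
  qed
  ultimately have "(\<Sum>k. 1 / real (Suc k) ^ 4) = pi ^ 4 / 90"
    by (rule tendsto_unique[rotated]) simp
  thus ?thesis
    using summ by (simp add: sums_iff)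
qed

lemma zeta_2: "zeta 2 = pi\<^sup>2 / 6"
  using sums_unique2[OF zeta_of_nat_sums[of 2]] inverse_squares_sums by simp

lemma zeta_4: "zeta 4 = pi ^ 4 / 90"
  using sums_unique2[OF zeta_of_nat_sums[of 4]] inverse_fourth_powers_sums by simp

theorem theorem1:
  shows "(\<forall>n::nat. n > 1 \<longrightarrow>
            (\<lambda>N. 1 / real N * (\<Sum>m=1..N. \<Prod>p | prime p \<and> p dvd m. (1 + 1 / real p ^ (n - 1))))
              \<longlonglongrightarrow> zeta (real n) / zeta (real (2 * n)))
       \<and> (\<lambda>N. 1 / real N * (\<Sum>m=1..N. \<Prod>p | prime p \<and> p dvd m. (1 + 1 / real p ^ (2 - 1))))
              \<longlonglongrightarrow> 15 / pi\<^sup>2"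
proof -
  have *: "(\<lambda>N. 1 / real N * (\<Sum>m=1..N. \<Prod>p | prime p \<and> p dvd m. (1 + 1 / real p ^ (n - 1))))
              \<longlonglongrightarrow> zeta (real n) / zeta (real (2 * n))" if n: "n > 1" for n
  proof -
    \<comment> \<open>Positivity permits dividing the identity between the squarefree sum and the
      two zeta values by \<open>zeta (real (2 * n))\<close>.\<close>
    have "zeta (real (2 * n)) > 0"
      using zeta_of_nat_sums[of "2 * n"] n suminf_pos[of "\<lambda>k. 1 / real (Suc k) ^ (2 * n)"]
      by (simp add: sums_iff del: of_nat_Suc)
    hence "(\<Sum>d. if squarefree d then 1 / real d ^ n else 0) = zeta (real n) / zeta (real (2 * n))"
      using suminf_squarefree_times_zeta[OF n] by (simp add: field_simps)
    moreover have "Suc (n - 1) = n"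
      using n by simp
    ultimately show ?thesis
      using tendsto_mean_prod_prime_divisors[of "n - 1"] n by (simp only: zero_less_diff)
  qed
  moreover have "zeta (real 2) / zeta (real (2 * 2)) = 15 / pi\<^sup>2"
    by (simp add: zeta_2 zeta_4 field_simps eval_nat_numeral)
  ultimately show ?thesis
    using *[of 2] by auto
qed

end
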